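(* Let $m\ge 1$, $N=2^m$, and let $\mathcal{A}=\{I_1<I_2<\dots<I_K\}\subseteq\{1,\dots,N\}$ be an arbitrary information set with $K \geq 1$ elements. Let $T$ be a random $N\times N$ upper-triangular matrix over $\mathbb{F}_2$ with all ones on the diagonal and whose entries $T_{ij}$, $1\le i<j\le N$, are i.i.d. Bernoulli$(1/2)$. Let $N_d(\mathcal{A},T)$ be the number of codewords of Hamming weight $d$ of the pre-transformed polar code with information set $\mathcal{A}$ and pre-transformation $T$. Then for every integer $d\ge 1$, $$E\left[N_d(\mathcal{A},T)\right]=\sum_{\substack{1\le j\le K\\ w(f_N^{(I_j)})\le d}}2^{K-j}\,P(m,I_j,d),$$ where $P(m,i,d)=\Pr\left(w(g_{2^m}^{(i)})=d\right)$ and the expectation and probability are with respect to $T$.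
   Context: All vectors and matrices are over $\mathbb{F}_2$; $w(\cdot)$ denotes Hamming weight. Let $F=\begin{bmatrix}1&0\\1&1\end{bmatrix}$, $N=2^m$, and $F_N=F^{\otimes m}$ (Kronecker power). For $1\le i\le N$, $f_N^{(i)}$ is the $i$-th row of $F_N$. For an upper-triangular matrix $T\in\mathbb{F}_2^{N\times N}$ with all ones on the diagonal, put $G_N=TF_N$, and let $g_N^{(i)}$ be the $i$-th row of $G_N$, so $g_N^{(i)}=f_N^{(i)}\oplus\sum_{j=i+1}^{N}T_{ij}f_N^{(j)}$. The pre-transformed polar code with information set $\mathcal{A}\subseteq\{1,\dots,N\}$ is $\{uG_N : u\in\mathbb{F}_2^N,\ u_i=0 \text{ for all } i\notin\mathcal{A}\}$. *)

theory Defs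
  imports
    "HOL-Probability.Probability"
    "HOL-Library.Z2"
    "Jordan_Normal_Form.Matrix"
begin

text \<open>
  Vectors and matrices are those of \<open>Jordan_Normal_Form\<close>, whose entries are numbered from 0.
  The definitions below that take row or coordinate numbers \<open>i\<close>, \<open>j\<close> number them
  from 1, which accounts for the shifts by one.
\<close>

definition hamming_weight :: "bit Matrix.vec \<Rightarrow> nat" where
  "hamming_weight v = card {k. k < dim_vec v \<and> vec_index v k \<noteq> 0}"

definition kronecker :: "'a::times Matrix.mat \<Rightarrow> 'a Matrix.mat \<Rightarrow> 'a Matrix.mat" where
  "kronecker A B = Matrix.mat (dim_row A * dim_row B) (dim_col A * dim_col B)
     (\<lambda>(i, j). A $$ (i div dim_row B, j div dim_col B) * B $$ (i mod dim_row B, j mod dim_col B))"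

primrec kronecker_power :: "'a::semiring_1 Matrix.mat \<Rightarrow> nat \<Rightarrow> 'a Matrix.mat" where
  "kronecker_power A 0 = 1\<^sub>m 1"
| "kronecker_power A (Suc m) = kronecker A (kronecker_power A m)"

definition polar_kernel :: "bit Matrix.mat" where
  "polar_kernel = mat_of_rows_list 2 [[1, 0], [1, 1]]"

text \<open>The matrices \<open>F\<^sub>N\<close> and \<open>G\<^sub>N = T F\<^sub>N\<close> for \<open>N = 2\<^sup>m\<close>.\<close>

definition polar_mat :: "nat \<Rightarrow> bit Matrix.mat" where
  "polar_mat m = kronecker_power polar_kernel m"

definition pre_transformed_mat :: "nat \<Rightarrow> bit Matrix.mat \<Rightarrow> bit Matrix.mat" where
  "pre_transformed_mat m T = T * polar_mat m"

definition f_row :: "nat \<Rightarrow> nat \<Rightarrow> bit Matrix.vec" where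
  "f_row m i = Matrix.row (polar_mat m) (i - 1)"

definition g_row :: "nat \<Rightarrow> bit Matrix.mat \<Rightarrow> nat \<Rightarrow> bit Matrix.vec" where
  "g_row m T i = Matrix.row (pre_transformed_mat m T) (i - 1)"

text \<open>The row vector \<open>u G\<close> is written as \<open>G\<^sup>T u\<close>.\<close>

definition pre_transformed_code :: "nat \<Rightarrow> nat set \<Rightarrow> bit Matrix.mat \<Rightarrow> bit Matrix.vec set" where
  "pre_transformed_code m A T =
     {transpose_mat (pre_transformed_mat m T) *\<^sub>v u | u.
        u \<in> carrier_vec (2 ^ m) \<and> (\<forall>i\<in>{1..2 ^ m} - A. vec_index u (i - 1) = 0)}"

definition num_codewords :: "nat \<Rightarrow> nat set \<Rightarrow> bit Matrix.mat \<Rightarrow> nat \<Rightarrow> nat" where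
  "num_codewords m A T d = card {c \<in> pre_transformed_code m A T. hamming_weight c = d}"

definition unit_upper_triangular :: "nat \<Rightarrow> bit Matrix.mat \<Rightarrow> bool" where
  "unit_upper_triangular N T \<longleftrightarrow>
     T \<in> carrier_mat N N \<and> upper_triangular T \<and> (\<forall>k<N. T $$ (k, k) = 1)"

text \<open>
  A random matrix on the probability space \<open>M\<close>, unit upper triangular of size \<open>N\<close>, whose
  entries above the diagonal are independent and uniformly distributed bits.
\<close>

definition random_pre_transformation ::
    "'w measure \<Rightarrow> nat \<Rightarrow> ('w \<Rightarrow> bit Matrix.mat) \<Rightarrow> bool" where
  "random_pre_transformation M N T \<longleftrightarrow>
     (\<forall>\<omega>\<in>space M. unit_upper_triangular N (T \<omega>)) \<and>
     prob_space.indep_vars M (\<lambda>_. count_space UNIV)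
       (\<lambda>(i, j) \<omega>. T \<omega> $$ (i - 1, j - 1)) {(i, j). 1 \<le> i \<and> i < j \<and> j \<le> N} \<and>
     (\<forall>i j. 1 \<le> i \<and> i < j \<and> j \<le> N \<longrightarrow>
        distr M (count_space UNIV) (\<lambda>\<omega>. T \<omega> $$ (i - 1, j - 1)) =
          measure_pmf (map_pmf of_bool (bernoulli_pmf (1 / 2))))"

text \<open>\<open>P(m, i, d)\<close>, with respect to the random matrix \<open>T\<close> on \<open>M\<close>.\<close>

definition row_weight_prob ::
    "'w measure \<Rightarrow> ('w \<Rightarrow> bit Matrix.mat) \<Rightarrow> nat \<Rightarrow> nat \<Rightarrow> nat \<Rightarrow> real" where
  "row_weight_prob M T m i d = measure M {\<omega> \<in> space M. hamming_weight (g_row m (T \<omega>) i) = d}"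

end

theory Submission
  imports Defs "Jordan_Normal_Form.Determinant"
begin

text \<open>
  Since \<open>T F\<^sub>N\<close> is invertible, codewords correspond to messages \<open>u\<close>, and expectations are averages
  over all unit upper triangular matrices. Let \<open>i\<close> be the position of the first nonzero entry of a
  nonzero message \<open>u\<close>. Replacing row \<open>i\<close> of the identity by \<open>u\<close> gives a unit upper triangular
  \<open>L\<close>, and \<open>T \<mapsto> L T\<close> is a bijection that turns \<open>g\<^sup>(\<^sup>i\<^sup>)\<close> into \<open>u T F\<^sub>N\<close>; so
  \<open>u T F\<^sub>N\<close> has weight \<open>d\<close> with probability \<open>P(m, i, d)\<close>. There are \<open>2\<^sup>K\<^sup>-\<^sup>j\<close> messages with
  leading position \<open>I\<^sub>j\<close>. The terms with \<open>w(f\<^sup>(\<^sup>i\<^sup>)) > d\<close> vanish because adding later rows of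
  \<open>F\<^sub>N\<close> to \<open>f\<^sup>(\<^sup>i\<^sup>)\<close> never decreases its weight.
\<close>

section \<open>Matrices over a field\<close>

text \<open>Links the two notations for a vector times a matrix: \<open>g_row\<close> is a row of a
  product, codewords are \<open>transpose_mat\<close> applied to a message.\<close>

lemma row_mult_eq_transpose_mult_vec:
  fixes A B :: "'a::comm_semiring_0 Matrix.mat"
  assumes "A \<in> carrier_mat n k" "B \<in> carrier_mat k p" "i < n"
  shows "Matrix.row (A * B) i = transpose_mat B *\<^sub>v Matrix.row A i"
proof (rule eq_vecI)
  fix j assume "j < dim_vec (transpose_mat B *\<^sub>v Matrix.row A i)"
  then have "j < p" using assms by simp
  then show "vec_index (Matrix.row (A * B) i) j = vec_index (transpose_mat B *\<^sub>v Matrix.row A i) j"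
    using assms by (simp add: comm_scalar_prod[where n = k])
qed (use assms in simp)

text \<open>The difference \<open>x - y\<close> lies in the kernel of \<open>A\<close>, which is
  trivial for nonzero determinant. This makes the encoding of messages injective.\<close>

lemma mult_mat_vec_cancel:
  fixes A :: "'a::field Matrix.mat"
  assumes A: "A \<in> carrier_mat n n" "Determinant.det A \<noteq> 0"
    and x: "x \<in> carrier_vec n" and y: "y \<in> carrier_vec n"
    and eq: "A *\<^sub>v x = A *\<^sub>v y"
  shows "x = y"
proof -
  have "A *\<^sub>v (x - y) = 0\<^sub>v n"
    using A x y eq by (simp add: mult_minus_distrib_mat_vec[of A n n])
  then have "x - y = 0\<^sub>v n"
    using det_0_iff_vec_prod_zero_field[OF A(1)] A(2) x y by (metis minus_carrier_vec)
  then have "vec_index (x - y) k = 0" if "k < n" for k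
    using that by simp
  then show ?thesis
    using x y by (intro eq_vecI) auto
qed

text \<open>Cancellation for vectors, applied to each column. It serves to show that left
  multiplication by a unit triangular matrix is injective.\<close>

lemma mult_mat_cancel:
  fixes A :: "'a::field Matrix.mat"
  assumes A: "A \<in> carrier_mat n n" "Determinant.det A \<noteq> 0"
    and B: "B \<in> carrier_mat n p" and C: "C \<in> carrier_mat n p"
    and eq: "A * B = A * C"
  shows "B = C"
proof (rule eq_matI)
  fix i j assume ij: "i < dim_row C" "j < dim_col C"
  have "A *\<^sub>v Matrix.col B j = A *\<^sub>v Matrix.col C j"
    using col_mult2[OF A(1) B] col_mult2[OF A(1) C] eq ij C by simp
  moreover have "Matrix.col B j \<in> carrier_vec n" "Matrix.col C j \<in> carrier_vec n"
    using B C by auto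
  ultimately have "Matrix.col B j = Matrix.col C j"
    by (metis mult_mat_vec_cancel[OF A])
  then have "vec_index (Matrix.col B j) i = vec_index (Matrix.col C j) i" by simp
  then show "B $$ (i, j) = C $$ (i, j)"
    using B C ij by simp
qed (use B C in auto)

section \<open>Unit upper triangular matrices\<close>

lemma unit_upper_triangularD:
  assumes "unit_upper_triangular N t"
  shows "t \<in> carrier_mat N N" "\<And>i j. j < i \<Longrightarrow> i < N \<Longrightarrow> t $$ (i, j) = 0"
    "\<And>k. k < N \<Longrightarrow> t $$ (k, k) = 1"
  using assms by (auto simp: unit_upper_triangular_def upper_triangular_def)

lemma det_unit_upper_triangular:
  assumes "unit_upper_triangular N t"
  shows "Determinant.det t = 1"
proof -
  have "Determinant.det t = prod_list (diag_mat t)"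
    using assms by (intro det_upper_triangular) (auto simp: unit_upper_triangular_def)
  also have "\<dots> = 1"
    using assms by (auto simp: prod_list_diag_prod unit_upper_triangular_def intro!: prod.neutral)
  finally show ?thesis .
qed

lemma unit_upper_triangular_mult:
  assumes s: "unit_upper_triangular N s" and t: "unit_upper_triangular N t"
  shows "unit_upper_triangular N (s * t)"
proof -
  note sD = unit_upper_triangularD[OF s] and tD = unit_upper_triangularD[OF t]
  have ent: "(s * t) $$ (i, j) = (\<Sum>k<N. s $$ (i, k) * t $$ (k, j))" if "i < N" "j < N" for i j
    using that sD(1) tD(1) by (simp add: scalar_prod_def lessThan_atLeast0)
  have "(s * t) $$ (i, j) = 0" if "j < i" "i < N" for i j
  proof -
    \<comment> \<open>Either \<open>k < i\<close> and the entry of \<open>s\<close> is below the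
      diagonal, or \<open>j < i \<le> k\<close> and the entry of \<open>t\<close> is.\<close>
    have "s $$ (i, k) * t $$ (k, j) = 0" if "k < N" for k
      using sD(2)[of k i] tD(2)[of j k] \<open>j < i\<close> \<open>i < N\<close> that by (cases "k < i") auto
    moreover have "j < N" using that by simp
    ultimately show ?thesis
      unfolding ent[OF \<open>i < N\<close> \<open>j < N\<close>] by (intro sum.neutral) auto
  qed
  moreover have "(s * t) $$ (i, i) = 1" if i: "i < N" for i
  proof -
    have "s $$ (i, k) * t $$ (k, i) = (if k = i then 1 else 0)" if "k < N" for k
      using sD(2)[of k i] tD(2)[of i k] sD(3) tD(3) i that by (cases k i rule: linorder_cases) auto
    then show ?thesis using i by (simp add: ent)
  qed
  ultimately show ?thesis
    using sD(1) tD(1) by (auto simp: unit_upper_triangular_def)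
qed

text \<open>A matrix of given size over F2 is determined by the set of positions of its
  ones.\<close>

lemma finite_unit_upper_triangular: "finite {t. unit_upper_triangular N t}"
proof (rule inj_on_finite)
  let ?f = "\<lambda>t::bit Matrix.mat. {p. p \<in> {..<N} \<times> {..<N} \<and> t $$ p = 1}"
  show "?f ` {t. unit_upper_triangular N t} \<subseteq> Pow ({..<N} \<times> {..<N})" by auto
  show "inj_on ?f {t. unit_upper_triangular N t}"
  proof (rule inj_onI)
    fix s t assume st: "s \<in> {t. unit_upper_triangular N t}" "t \<in> {t. unit_upper_triangular N t}"
      and eq: "?f s = ?f t"
    have c: "s \<in> carrier_mat N N" "t \<in> carrier_mat N N"
      using st by (auto dest: unit_upper_triangularD)
    show "s = t"
    proof (rule eq_matI)
      fix i j assume "i < dim_row t" "j < dim_col t"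
      then have "s $$ (i, j) = 1 \<longleftrightarrow> t $$ (i, j) = 1"
        using eq c by (auto simp: set_eq_iff)
      then show "s $$ (i, j) = t $$ (i, j)"
        by (metis bit_not_one_iff)
    qed (use c in auto)
  qed
  show "finite (Pow ({..<N} \<times> {..<N}))" by simp
qed

section \<open>Row weights of the polar matrix\<close>

lemma polar_mat_carrier: "polar_mat m \<in> carrier_mat (2 ^ m) (2 ^ m)"
proof (induction m)
  case 0
  then show ?case by (simp add: polar_mat_def)
next
  case (Suc m)
  have "dim_row polar_kernel = 2" "dim_col polar_kernel = 2"
    by (simp_all add: polar_kernel_def mat_of_rows_list_def)
  with Suc show ?case
    by (intro carrier_matI) (auto simp: polar_mat_def kronecker_def)
qed

text \<open>Entrywise form of the block matrix with block rows \<open>(P, 0)\<close> and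
  \<open>(P, P)\<close>, where \<open>P = polar_mat m\<close>: division by \<open>2 ^ m\<close>
  selects the block, the remainder the place in it.\<close>

lemma polar_mat_Suc:
  assumes "k < 2 ^ m" "l < 2 ^ m"
  shows "polar_mat (Suc m) $$ (k, l) = polar_mat m $$ (k, l)"
    "polar_mat (Suc m) $$ (k, 2 ^ m + l) = 0"
    "polar_mat (Suc m) $$ (2 ^ m + k, l) = polar_mat m $$ (k, l)"
    "polar_mat (Suc m) $$ (2 ^ m + k, 2 ^ m + l) = polar_mat m $$ (k, l)"
proof -
  have P: "polar_mat (Suc m) = kronecker polar_kernel (polar_mat m)"
    by (simp add: polar_mat_def)
  have K: "polar_kernel $$ (0, 0) = 1" "polar_kernel $$ (0, Suc 0) = 0"
    "polar_kernel $$ (Suc 0, 0) = 1" "polar_kernel $$ (Suc 0, Suc 0) = 1"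
    "dim_row polar_kernel = 2" "dim_col polar_kernel = 2"
    by (simp_all add: polar_kernel_def mat_of_rows_list_def)
  have d: "dim_row (polar_mat m) = 2 ^ m" "dim_col (polar_mat m) = 2 ^ m"
    using polar_mat_carrier[of m] by auto
  have q: "(2 ^ m + x) div 2 ^ m = Suc 0" "(2 ^ m + x) mod 2 ^ m = x" if "x < 2 ^ m" for x :: nat
    using that by (simp_all add: div_add_self1)
  show "polar_mat (Suc m) $$ (k, l) = polar_mat m $$ (k, l)"
    "polar_mat (Suc m) $$ (k, 2 ^ m + l) = 0"
    "polar_mat (Suc m) $$ (2 ^ m + k, l) = polar_mat m $$ (k, l)"
    "polar_mat (Suc m) $$ (2 ^ m + k, 2 ^ m + l) = polar_mat m $$ (k, l)"
    using assms by (simp_all add: P kronecker_def K d q)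
qed

lemma less_double_cases:
  fixes i n :: nat
  assumes "i < 2 * n"
  obtains "i < n" | j where "j < n" "i = n + j"
  using assms by (metis add_less_cancel_left le_Suc_ex mult_2 not_le)

text \<open>In the block form the upper right block is zero and both diagonal blocks are
  \<open>polar_mat m\<close>, so the shape is inherited.\<close>

lemma polar_mat_unit_lower_triangular:
  "i < 2 ^ m \<Longrightarrow> j < 2 ^ m \<Longrightarrow> i \<le> j \<Longrightarrow> polar_mat m $$ (i, j) = of_bool (i = j)"
proof (induction m arbitrary: i j)
  case 0
  then show ?case by (simp add: polar_mat_def)
next
  case (Suc m)
  have "i < 2 * 2 ^ m" "j < 2 * 2 ^ m" using Suc.prems by auto
  then show ?case
    using Suc.prems(3)
    by (elim less_double_cases) (auto simp: polar_mat_Suc Suc.IH)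
qed

lemma det_polar_mat: "Determinant.det (polar_mat m) = 1"
proof -
  have "Determinant.det (polar_mat m) = prod_list (diag_mat (polar_mat m))"
    by (rule det_lower_triangular[OF _ polar_mat_carrier])
      (auto simp: polar_mat_unit_lower_triangular)
  also have "\<dots> = 1"
    using polar_mat_carrier[of m]
    by (auto simp: prod_list_diag_prod polar_mat_unit_lower_triangular intro!: prod.neutral)
  finally show ?thesis .
qed

lemma sum_lessThan_double:
  fixes g :: "nat \<Rightarrow> 'a::comm_monoid_add"
  shows "(\<Sum>k<2 * n. g k) = (\<Sum>k<n. g k) + (\<Sum>k<n. g (n + k))"
proof -
  have "(\<Sum>k<2 * n. g k) = (\<Sum>k<n. g k) + (\<Sum>k=n..<n + n. g k)"
    by (simp add: lessThan_atLeast0 sum.atLeastLessThan_concat mult_2)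
  also have "(\<Sum>k=n..<n + n. g k) = (\<Sum>k<n. g (n + k))"
    using sum.shift_bounds_nat_ivl[of g 0 n n] by (simp add: lessThan_atLeast0 add.commute)
  finally show ?thesis .
qed

lemma card_filter_eq_sum:
  "finite S \<Longrightarrow> card {x \<in> S. P x} = (\<Sum>x\<in>S. of_bool (P x))"
  by (simp only: card_eq_sum sum.inter_filter of_bool_def)

lemma card_lessThan_double:
  fixes Q :: "nat \<Rightarrow> bool"
  shows "card {k. k < 2 * n \<and> Q k} = card {k. k < n \<and> Q k} + card {k. k < n \<and> Q (n + k)}"
proof -
  have *: "card {k. k < p \<and> R k} = (\<Sum>k<p. of_bool (R k))" for p and R :: "nat \<Rightarrow> bool"
    using card_filter_eq_sum[of "{..<p}" R] by simp
  show ?thesis unfolding * by (rule sum_lessThan_double)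
qed

text \<open>
  The block form \<open>(a, b) F\<^sub>2\<^sub>N = ((a + b) F\<^sub>N, b F\<^sub>N)\<close> and
  \<open>w(x) \<le> w(x + y) + w(y)\<close> drive the induction.
\<close>

lemma polar_row_weight_le_aux:
  fixes v :: "nat \<Rightarrow> bit"
  assumes "i < 2 ^ m" "v i = 1" "\<And>j. j < i \<Longrightarrow> v j = 0"
  shows "card {k. k < 2 ^ m \<and> polar_mat m $$ (i, k) \<noteq> 0} \<le>
    card {k. k < 2 ^ m \<and> (\<Sum>j<2 ^ m. polar_mat m $$ (j, k) * v j) \<noteq> 0}"
  using assms
proof (induction m arbitrary: i v)
  case 0
  then show ?case by (simp add: polar_mat_def)
next
  case (Suc m)
  define n :: nat where "n = 2 ^ m"
  \<comment> \<open>\<open>b\<close> is the second half of \<open>v\<close>. The first half needs no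
    name of its own, since \<open>E\<close> reads only the entries below \<open>n\<close>.\<close>
  define b where "b = (\<lambda>j. v (n + j))"
  define E where "E = (\<lambda>v k. \<Sum>j<n. polar_mat m $$ (j, k) * v j)"
  define E' where "E' = (\<lambda>k. \<Sum>j<2 * n. polar_mat (Suc m) $$ (j, k) * v j)"
  have E'1: "E' k = E v k + E b k" if "k < n" for k
    using that by (simp add: E'_def E_def b_def sum_lessThan_double n_def polar_mat_Suc
      del: sum_of_bool_eq add_bit_eq_xor mult_bit_eq_and)
  have E'2: "E' (n + k) = E b k" if "k < n" for k
    using that by (simp add: E'_def E_def b_def sum_lessThan_double n_def polar_mat_Suc
      del: sum_of_bool_eq add_bit_eq_xor mult_bit_eq_and)
  have R: "card {k. k < 2 * n \<and> E' k \<noteq> 0} =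
      card {k. k < n \<and> E v k + E b k \<noteq> 0} + card {k. k < n \<and> E b k \<noteq> 0}"
    unfolding card_lessThan_double
    by (intro arg_cong2[of _ _ _ _ "(+)"] arg_cong[of _ _ card]) (auto simp: E'1 E'2)
  have IH: "card {k. k < n \<and> polar_mat m $$ (i, k) \<noteq> 0} \<le> card {k. k < n \<and> E v k \<noteq> 0}"
    if "i < n" "v i = 1" "\<And>j. j < i \<Longrightarrow> v j = 0" for i v
    using Suc.IH[of i v] that by (simp add: n_def E_def)
  have "i < 2 * n" using Suc.prems(1) by (simp add: n_def)
  then have "card {k. k < 2 * n \<and> polar_mat (Suc m) $$ (i, k) \<noteq> 0} \<le>
      card {k. k < 2 * n \<and> E' k \<noteq> 0}"
  proof (cases rule: less_double_cases)
    \<comment> \<open>Here row \<open>i\<close> is \<open>(r, 0)\<close> with \<open>r\<close> row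
      \<open>i\<close> of \<open>polar_mat m\<close>. The induction hypothesis for the first half of
      \<open>v\<close> bounds the weight of \<open>r\<close>, and wherever \<open>E v\<close> is
      nonzero, \<open>E v + E b\<close> or \<open>E b\<close> is.\<close>
    case 1
    have "card {k. k < 2 * n \<and> polar_mat (Suc m) $$ (i, k) \<noteq> 0} =
        card {k. k < n \<and> polar_mat m $$ (i, k) \<noteq> 0} + card ({} :: nat set)"
      unfolding card_lessThan_double using 1
      by (intro arg_cong2[of _ _ _ _ "(+)"] arg_cong[of _ _ card])
        (auto simp: polar_mat_Suc n_def)
    also have "\<dots> \<le> card {k. k < n \<and> E v k \<noteq> 0}"
      using IH[of i v] 1 Suc.prems by simp
    also have "\<dots> \<le> card ({k. k < n \<and> E v k + E b k \<noteq> 0} \<union> {k. k < n \<and> E b k \<noteq> 0})"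
      by (intro card_mono) auto
    also have "\<dots> \<le> card {k. k < n \<and> E v k + E b k \<noteq> 0} + card {k. k < n \<and> E b k \<noteq> 0}"
      by (rule card_Un_le)
    finally show ?thesis by (simp only: R)
  next
    \<comment> \<open>Here row \<open>i\<close> is \<open>(r, r)\<close> and the first half of
      \<open>v\<close> is zero, so both halves of the image equal \<open>E b\<close>. The induction
      hypothesis for \<open>b\<close> is used once for each half.\<close>
    case (2 i')
    have "E v k = 0" for k
      unfolding E_def using Suc.prems(3) 2 by (intro sum.neutral) auto
    moreover have "card {k. k < 2 * n \<and> polar_mat (Suc m) $$ (i, k) \<noteq> 0} =
        card {k. k < n \<and> polar_mat m $$ (i', k) \<noteq> 0} +
        card {k. k < n \<and> polar_mat m $$ (i', k) \<noteq> 0}"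
      unfolding card_lessThan_double using 2
      by (intro arg_cong2[of _ _ _ _ "(+)"] arg_cong[of _ _ card])
        (auto simp: polar_mat_Suc n_def)
    moreover have "card {k. k < n \<and> polar_mat m $$ (i', k) \<noteq> 0} \<le> card {k. k < n \<and> E b k \<noteq> 0}"
      using IH[of i' b] 2 Suc.prems by (simp add: b_def)
    ultimately show ?thesis
      unfolding R by simp
  qed
  then show ?case by (simp add: n_def E'_def)
qed

lemma polar_row_weight_le:
  assumes "v \<in> carrier_vec (2 ^ m)" "i < 2 ^ m" "vec_index v i = 1"
    and "\<And>j. j < i \<Longrightarrow> vec_index v j = 0"
  shows "hamming_weight (Matrix.row (polar_mat m) i) \<le>
    hamming_weight (transpose_mat (polar_mat m) *\<^sub>v v)"
proof -
  have "{k. k < dim_vec (Matrix.row (polar_mat m) i) \<and> vec_index (Matrix.row (polar_mat m) i) k \<noteq> 0}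
      = {k. k < 2 ^ m \<and> polar_mat m $$ (i, k) \<noteq> 0}"
    using polar_mat_carrier[of m] assms(2) by auto
  moreover have "{k. k < dim_vec (transpose_mat (polar_mat m) *\<^sub>v v) \<and>
      vec_index (transpose_mat (polar_mat m) *\<^sub>v v) k \<noteq> 0}
      = {k. k < 2 ^ m \<and> (\<Sum>j<2 ^ m. polar_mat m $$ (j, k) * vec_index v j) \<noteq> 0}"
    using polar_mat_carrier[of m] assms(1) by (auto simp: scalar_prod_def lessThan_atLeast0)
  ultimately show ?thesis
    unfolding hamming_weight_def
    using polar_row_weight_le_aux[of i m "vec_index v"] assms by simp
qed

section \<open>Counting codewords\<close>

lemma pre_transformed_mat_carrier:
  "t \<in> carrier_mat (2 ^ m) (2 ^ m) \<Longrightarrow> pre_transformed_mat m t \<in> carrier_mat (2 ^ m) (2 ^ m)"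
  using polar_mat_carrier[of m] by (simp add: pre_transformed_mat_def)

text \<open>Row \<open>i - 1\<close> of \<open>t\<close> is zero before the diagonal and one on it,
  so it can serve as the coefficient vector in \<open>polar_row_weight_le\<close>.\<close>

lemma hamming_weight_g_row_ge:
  assumes t: "unit_upper_triangular (2 ^ m) t" and i: "i \<in> {1..2 ^ m}"
  shows "hamming_weight (f_row m i) \<le> hamming_weight (g_row m t i)"
proof -
  note tD = unit_upper_triangularD[OF t]
  have i': "i - 1 < 2 ^ m" using i by auto
  have "hamming_weight (Matrix.row (polar_mat m) (i - 1)) \<le>
      hamming_weight (transpose_mat (polar_mat m) *\<^sub>v Matrix.row t (i - 1))"
    using tD i' by (intro polar_row_weight_le) auto
  then show ?thesis
    unfolding f_row_def g_row_def pre_transformed_mat_def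
    using row_mult_eq_transpose_mult_vec[OF tD(1) polar_mat_carrier i'] by simp
qed

text \<open>The symmetry argument: multiplication by \<open>L\<close> permutes the unit upper
  triangular matrices, so the count for \<open>u\<close> depends only on its leading position
  \<open>i\<close>.\<close>

lemma card_codeword_weight_eq_card_g_row_weight:
  assumes i: "i \<in> {1..2 ^ m}" and u: "u \<in> carrier_vec (2 ^ m)"
    and ui: "vec_index u (i - 1) = 1" and u0: "\<And>k. k < i - 1 \<Longrightarrow> vec_index u k = 0"
  shows "card {t. unit_upper_triangular (2 ^ m) t \<and>
      hamming_weight (transpose_mat (pre_transformed_mat m t) *\<^sub>v u) = d} =
    card {t. unit_upper_triangular (2 ^ m) t \<and> hamming_weight (g_row m t i) = d}"
proof -
  define N :: nat where "N = 2 ^ m"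
  define L where "L = Matrix.mat N N
    (\<lambda>(r, k). if r = i - 1 then vec_index u k else of_bool (r = k))"
  have i': "i - 1 < N" using i by (auto simp: N_def)
  have L: "unit_upper_triangular N L"
    using ui u0 by (auto simp: unit_upper_triangular_def L_def upper_triangular_def)
  note LD = unit_upper_triangularD[OF L]
  have Lrow: "Matrix.row L (i - 1) = u"
    using u i' by (auto simp: L_def N_def intro!: eq_vecI)
  let ?U = "{t. unit_upper_triangular N t}"
  have inj: "inj_on ((*) L) ?U"
    by (rule inj_onI, rule mult_mat_cancel[OF LD(1), where p = N])
      (auto simp: det_unit_upper_triangular[OF L] dest: unit_upper_triangularD)
  have "(*) L ` ?U \<subseteq> ?U"
    using unit_upper_triangular_mult[OF L] by auto
  \<comment> \<open>An injective map of a finite set into itself is onto.\<close>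
  then have img: "(*) L ` ?U = ?U"
    using endo_inj_surj[OF finite_unit_upper_triangular _ inj] by blast
  have g: "g_row m (L * t) i = transpose_mat (pre_transformed_mat m t) *\<^sub>v u"
    if t: "t \<in> ?U" for t
  proof -
    have tc: "t \<in> carrier_mat N N" using t by (auto dest: unit_upper_triangularD)
    \<comment> \<open>Regrouped so that row \<open>i - 1\<close> of \<open>L\<close>, which is
      \<open>u\<close>, multiplies the generator matrix of \<open>t\<close>.\<close>
    have "L * t * polar_mat m = L * (t * polar_mat m)"
      using LD(1) tc polar_mat_carrier[of m] by (simp add: N_def assoc_mult_mat)
    moreover have "t * polar_mat m \<in> carrier_mat N N"
      using tc polar_mat_carrier[of m] by (simp add: N_def)
    ultimately show ?thesis
      unfolding g_row_def pre_transformed_mat_def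
      using row_mult_eq_transpose_mult_vec[OF LD(1) _ i'] Lrow by simp
  qed
  let ?A = "{t \<in> ?U. hamming_weight (transpose_mat (pre_transformed_mat m t) *\<^sub>v u) = d}"
  have "{t \<in> ?U. hamming_weight (g_row m t i) = d} = (*) L ` ?A" (is "?B = _")
  proof
    show "(*) L ` ?A \<subseteq> ?B" using g img by auto
    show "?B \<subseteq> (*) L ` ?A"
    proof
      fix s assume s: "s \<in> ?B"
      then obtain t where "t \<in> ?U" "s = L * t" using img by blast
      with s g show "s \<in> (*) L ` ?A" by auto
    qed
  qed
  moreover have "card ((*) L ` ?A) = card ?A"
    using inj by (intro card_image) (auto intro: inj_on_subset)
  ultimately show ?thesis by (simp add: N_def)
qed

section \<open>Messages and their leading positions\<close>

definition messages :: "nat \<Rightarrow> nat set \<Rightarrow> bit Matrix.vec set" where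
  "messages m A = {u \<in> carrier_vec (2 ^ m). \<forall>i\<in>{1..2 ^ m} - A. vec_index u (i - 1) = 0}"

definition leading_messages :: "nat \<Rightarrow> nat set \<Rightarrow> nat \<Rightarrow> bit Matrix.vec set" where
  "leading_messages m A i =
    {u \<in> messages m A. vec_index u (i - 1) = 1 \<and> (\<forall>k<i - 1. vec_index u k = 0)}"

lemma finite_messages: "finite (messages m A)"
proof (rule inj_on_finite)
  let ?f = "\<lambda>u::bit Matrix.vec. {k. k < 2 ^ m \<and> vec_index u k = 1}"
  show "?f ` messages m A \<subseteq> Pow {..<2 ^ m}" by auto
  show "inj_on ?f (messages m A)"
  proof (rule inj_onI)
    fix u v assume uv: "u \<in> messages m A" "v \<in> messages m A" and eq: "?f u = ?f v"
    show "u = v"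
    proof (rule eq_vecI)
      fix k assume "k < dim_vec v"
      then have "vec_index u k = 1 \<longleftrightarrow> vec_index v k = 1"
        using eq uv by (auto simp: set_eq_iff messages_def)
      then show "vec_index u k = vec_index v k"
        by (metis bit_not_one_iff)
    qed (use uv in \<open>auto simp: messages_def\<close>)
  qed
  show "finite (Pow {..<2 ^ m :: nat})" by simp
qed

text \<open>Both factors of the generator matrix have determinant 1, so encoding is injective and
  codewords can be counted through their messages.\<close>

lemma num_codewords_eq_card_messages:
  assumes t: "unit_upper_triangular (2 ^ m) t"
  shows "num_codewords m A t d =
    card {u \<in> messages m A. hamming_weight (transpose_mat (pre_transformed_mat m t) *\<^sub>v u) = d}"
proof -
  let ?G = "transpose_mat (pre_transformed_mat m t)"
  note tD = unit_upper_triangularD[OF t]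
  have G: "pre_transformed_mat m t \<in> carrier_mat (2 ^ m) (2 ^ m)"
    by (rule pre_transformed_mat_carrier[OF tD(1)])
  have "Determinant.det (pre_transformed_mat m t) = 1"
    unfolding pre_transformed_mat_def
    using det_mult[OF tD(1) polar_mat_carrier] det_polar_mat det_unit_upper_triangular[OF t] by simp
  then have "Determinant.det ?G \<noteq> 0"
    using det_transpose[OF G] by simp
  then have inj: "inj_on ((*\<^sub>v) ?G) (messages m A)"
    using G by (intro inj_onI) (rule mult_mat_vec_cancel, auto simp: messages_def)
  have "{c \<in> pre_transformed_code m A t. hamming_weight c = d} =
      (*\<^sub>v) ?G ` {u \<in> messages m A. hamming_weight (?G *\<^sub>v u) = d}"
    by (auto simp: pre_transformed_code_def messages_def)
  then show ?thesis
    unfolding num_codewords_def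
    using inj by (auto intro!: card_image intro: inj_on_subset)
qed

text \<open>The entry at \<open>i\<close> is fixed to one and all earlier ones to zero; only the
  entries at positions of \<open>A\<close> beyond \<open>i\<close> remain free.\<close>

lemma card_leading_messages:
  assumes "A \<subseteq> {1..2 ^ m}" "i \<in> A"
  shows "card (leading_messages m A i) = 2 ^ card {k \<in> A. i < k}"
proof -
  let ?f = "\<lambda>u::bit Matrix.vec. {k \<in> A. i < k \<and> vec_index u (k - 1) = 1}"
  \<comment> \<open>The inverse of \<open>?f\<close>: a one at the leading position and at the
    chosen later ones. Index \<open>k\<close> of a vector is position \<open>Suc k\<close>.\<close>
  let ?g = "\<lambda>S. Matrix.vec (2 ^ m) (\<lambda>k. of_bool (Suc k = i \<or> Suc k \<in> S) :: bit)"
  have i: "1 \<le> i" "i \<le> 2 ^ m" using assms by auto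
  have "bij_betw ?f (leading_messages m A i) (Pow {k \<in> A. i < k})"
  proof (rule bij_betw_byWitness[where f' = ?g])
    show "\<forall>u\<in>leading_messages m A i. ?g (?f u) = u"
    proof
      fix u assume u: "u \<in> leading_messages m A i"
      then have uc: "u \<in> carrier_vec (2 ^ m)"
        and off: "\<And>k. k < 2 ^ m \<Longrightarrow> Suc k \<notin> A \<Longrightarrow> vec_index u k = 0"
        and ui: "vec_index u (i - 1) = 1" and u0: "\<And>k. k < i - 1 \<Longrightarrow> vec_index u k = 0"
        by (force simp: leading_messages_def messages_def)+
      show "?g (?f u) = u"
      proof (rule eq_vecI)
        fix k assume "k < dim_vec u"
        then have k: "k < 2 ^ m" using uc by simp
        consider "Suc k = i" | "Suc k < i" | "Suc k > i" by linarith
        then show "vec_index (?g (?f u)) k = vec_index u k"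
        proof cases
          case 1
          then show ?thesis using k ui by auto
        next
          case 2
          then show ?thesis using k u0[of k] by auto
        next
          case 3
          then show ?thesis using k off[of k] by (cases "vec_index u k") auto
        qed
      qed (use uc in auto)
    qed
    show "\<forall>S\<in>Pow {k \<in> A. i < k}. ?f (?g S) = S"
    proof
      fix S assume S: "S \<in> Pow {k \<in> A. i < k}"
      have "vec_index (?g S) (k - 1) = of_bool (k \<in> S)" if "k \<in> A" "i < k" for k
      proof -
        have "k - 1 < 2 ^ m" "Suc (k - 1) = k" using that assms(1) by force+
        then show ?thesis using that by simp
      qed
      then show "?f (?g S) = S" using S by auto
    qed
    show "?f ` leading_messages m A i \<subseteq> Pow {k \<in> A. i < k}" by auto
    show "?g ` Pow {k \<in> A. i < k} \<subseteq> leading_messages m A i"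
      using i assms(2) by (force simp: leading_messages_def messages_def)
  qed
  then have "card (leading_messages m A i) = card (Pow {k \<in> A. i < k})"
    by (rule bij_betw_same_card)
  also have "\<dots> = 2 ^ card {k \<in> A. i < k}"
    using finite_subset[OF assms(1)] by (intro card_Pow) auto
  finally show ?thesis .
qed

text \<open>A nonzero message has a least index with entry one; its position lies in
  \<open>A\<close> because entries at positions outside \<open>A\<close> are zero.\<close>

lemma messages_eq_Union_leading:
  assumes "A \<subseteq> {1..2 ^ m}"
  shows "messages m A - {0\<^sub>v (2 ^ m)} = (\<Union>i\<in>A. leading_messages m A i)"
proof
  show "messages m A - {0\<^sub>v (2 ^ m)} \<subseteq> (\<Union>i\<in>A. leading_messages m A i)"
  proof
    fix u assume u: "u \<in> messages m A - {0\<^sub>v (2 ^ m)}"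
    then have uc: "u \<in> carrier_vec (2 ^ m)"
      and off: "\<And>i. i \<in> {1..2 ^ m} \<Longrightarrow> i \<notin> A \<Longrightarrow> vec_index u (i - 1) = 0"
      by (auto simp: messages_def)
    have "\<exists>k. k < 2 ^ m \<and> vec_index u k = 1"
    proof (rule ccontr)
      assume "\<not> ?thesis"
      then have "u = 0\<^sub>v (2 ^ m)" using uc by (intro eq_vecI) auto
      then show False using u by simp
    qed
    then obtain k where k: "k < 2 ^ m" "vec_index u k = 1"
      and least: "\<And>l. l < k \<Longrightarrow> \<not> (l < 2 ^ m \<and> vec_index u l = 1)"
      using exists_least_iff[of "\<lambda>k. k < 2 ^ m \<and> vec_index u k = 1"] by blast
    have "Suc k \<in> A" using off[of "Suc k"] k by fastforce
    moreover have "vec_index u l = 0" if "l < k" for l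
      using least[OF that] that k by simp
    ultimately show "u \<in> (\<Union>i\<in>A. leading_messages m A i)"
      using u k by (auto simp: leading_messages_def intro!: bexI[of _ "Suc k"])
  qed
  show "(\<Union>i\<in>A. leading_messages m A i) \<subseteq> messages m A - {0\<^sub>v (2 ^ m)}"
    using assms by (fastforce simp: leading_messages_def)
qed

text \<open>For \<open>i < j\<close>, the entry at index \<open>i - 1\<close> is one in the first
  set and zero in the second. As positions start at 1, \<open>i - 1 < j - 1\<close> holds in spite
  of truncated subtraction.\<close>

lemma disjoint_leading_messages:
  assumes "A \<subseteq> {1..2 ^ m}"
  shows "disjoint_family_on (leading_messages m A) A"
  unfolding disjoint_family_on_def
proof (intro ballI impI)
  have *: "leading_messages m A i \<inter> leading_messages m A j = {}" if "i \<in> A" "i < j" for i j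
    using that assms by (fastforce simp: leading_messages_def)
  fix i j assume "i \<in> A" "j \<in> A" "i \<noteq> j"
  then show "leading_messages m A i \<inter> leading_messages m A j = {}"
    using *[of i j] *[of j i] by (cases i j rule: linorder_cases) auto
qed

text \<open>Double counting of the pairs of a matrix and a message whose codeword has weight
  \<open>d\<close>, with the messages then grouped by leading position.\<close>

lemma sum_num_codewords:
  assumes A: "A \<subseteq> {1..2 ^ m}" and d: "d \<ge> 1"
  shows "(\<Sum>t | unit_upper_triangular (2 ^ m) t. num_codewords m A t d) =
    (\<Sum>i\<in>A. 2 ^ card {k \<in> A. i < k} *
      card {t. unit_upper_triangular (2 ^ m) t \<and> hamming_weight (g_row m t i) = d})"
proof -
  let ?U = "{t. unit_upper_triangular (2 ^ m) t}"
  let ?w = "\<lambda>u t. hamming_weight (transpose_mat (pre_transformed_mat m t) *\<^sub>v u)"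
  let ?c = "\<lambda>u. card {t. unit_upper_triangular (2 ^ m) t \<and> ?w u t = d}"
  have finA: "finite A" using finite_subset[OF A] by simp
  \<comment> \<open>The zero message has no leading position; its codeword has weight 0, which
    \<open>d \<ge> 1\<close> excludes.\<close>
  have zero: "?c (0\<^sub>v (2 ^ m)) = 0"
  proof -
    have "?w (0\<^sub>v (2 ^ m)) t = 0" if "unit_upper_triangular (2 ^ m) t" for t
      using pre_transformed_mat_carrier[OF unit_upper_triangularD(1)[OF that]]
      by (simp add: hamming_weight_def scalar_prod_def)
    then have "{t. unit_upper_triangular (2 ^ m) t \<and> ?w (0\<^sub>v (2 ^ m)) t = d} = {}"
      using d by fastforce
    then show ?thesis by (simp only: card.empty)
  qed
  have "(\<Sum>t\<in>?U. num_codewords m A t d) =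
      (\<Sum>t\<in>?U. \<Sum>u\<in>messages m A. of_bool (?w u t = d))"
    by (intro sum.cong refl)
      (simp add: num_codewords_eq_card_messages card_filter_eq_sum finite_messages)
  also have "\<dots> = (\<Sum>u\<in>messages m A. \<Sum>t\<in>?U. of_bool (?w u t = d))"
    by (rule sum.swap)
  also have "\<dots> = (\<Sum>u\<in>messages m A. ?c u)"
    using card_filter_eq_sum[OF finite_unit_upper_triangular]
    by (intro sum.cong refl) simp
  also have "\<dots> = (\<Sum>u\<in>messages m A - {0\<^sub>v (2 ^ m)}. ?c u)"
    using zero by (intro sum.mono_neutral_right finite_messages) auto
  also have "\<dots> = (\<Sum>i\<in>A. \<Sum>u\<in>leading_messages m A i. ?c u)"
    unfolding messages_eq_Union_leading[OF A]
    using disjoint_leading_messages[OF A] finA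
    by (intro sum.UNION_disjoint)
      (auto simp: disjoint_family_on_def leading_messages_def intro: finite_subset[OF _ finite_messages])
  also have "\<dots> = (\<Sum>i\<in>A. \<Sum>u\<in>leading_messages m A i.
      card {t. unit_upper_triangular (2 ^ m) t \<and> hamming_weight (g_row m t i) = d})"
    using A by (intro sum.cong refl card_codeword_weight_eq_card_g_row_weight)
      (auto simp: leading_messages_def messages_def)
  also have "\<dots> = (\<Sum>i\<in>A. 2 ^ card {k \<in> A. i < k} *
      card {t. unit_upper_triangular (2 ^ m) t \<and> hamming_weight (g_row m t i) = d})"
    by (intro sum.cong refl) (simp add: card_leading_messages[OF A])
  finally show ?thesis .
qed

section \<open>The random matrix\<close>

text \<open>The random matrix is uniform: entries on and below the diagonal are forced, and each
  entry above it agrees with that of \<open>t\<close> independently with probability 1/2.\<close>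

lemma prob_random_pre_transformation_eq:
  assumes "prob_space M" and T: "random_pre_transformation M N T" and N: "N \<ge> 2"
    and t: "unit_upper_triangular N t"
  shows "{\<omega> \<in> space M. T \<omega> = t} \<in> sets M"
    and "measure M {\<omega> \<in> space M. T \<omega> = t} = (1 / 2) ^ card {(i, j). 1 \<le> i \<and> i < j \<and> j \<le> N}"
proof -
  interpret prob_space M by fact
  define J :: "(nat \<times> nat) set" where "J = {(i, j). 1 \<le> i \<and> i < j \<and> j \<le> N}"
  define X where "X = (\<lambda>(i, j) \<omega>. T \<omega> $$ (i - 1, j - 1))"
  define x where "x = (\<lambda>(i, j). t $$ (i - 1, j - 1))"
  have ut: "unit_upper_triangular N (T \<omega>)" if "\<omega> \<in> space M" for \<omega>
    using T that by (auto simp: random_pre_transformation_def)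
  have indep: "indep_vars (\<lambda>_. count_space UNIV) X J"
    using T by (simp add: random_pre_transformation_def X_def J_def)
  have distr: "distr M (count_space UNIV) (X p) =
      measure_pmf (map_pmf of_bool (bernoulli_pmf (1 / 2)))" if "p \<in> J" for p
    using T that by (auto simp: random_pre_transformation_def X_def J_def)
  have J: "finite J" "J \<noteq> {}"
  proof -
    show "finite J" by (rule finite_subset[of _ "{..N} \<times> {..N}"]) (auto simp: J_def)
    \<comment> \<open>Nonemptiness of \<open>J\<close> keeps the intersection below inside
      \<open>space M\<close> and is a premise of the product rule for independent variables.\<close>
    have "(1, 2) \<in> J" using N by (simp add: J_def)
    then show "J \<noteq> {}" by auto
  qed
  have meas: "X p \<in> measurable M (count_space UNIV)" if "p \<in> J" for p
    using indep that by (auto simp: indep_vars_def)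
  have eq: "{\<omega> \<in> space M. T \<omega> = t} = (\<Inter>p\<in>J. X p -` {x p} \<inter> space M)"
  proof
    show "{\<omega> \<in> space M. T \<omega> = t} \<subseteq> (\<Inter>p\<in>J. X p -` {x p} \<inter> space M)"
      by (auto simp: X_def x_def)
    show "(\<Inter>p\<in>J. X p -` {x p} \<inter> space M) \<subseteq> {\<omega> \<in> space M. T \<omega> = t}"
    proof
      fix \<omega> assume \<omega>: "\<omega> \<in> (\<Inter>p\<in>J. X p -` {x p} \<inter> space M)"
      then have sp: "\<omega> \<in> space M" using J(2) by auto
      note TD = unit_upper_triangularD[OF ut[OF sp]] and tD = unit_upper_triangularD[OF t]
      have "T \<omega> = t"
      proof (rule eq_matI)
        fix i j assume "i < dim_row t" "j < dim_col t"
        then have ij: "i < N" "j < N" using tD(1) by auto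
        show "T \<omega> $$ (i, j) = t $$ (i, j)"
        proof (cases i j rule: linorder_cases)
          case less
          then have "(Suc i, Suc j) \<in> J" using ij by (simp add: J_def)
          then have "X (Suc i, Suc j) \<omega> = x (Suc i, Suc j)" using \<omega> by blast
          then show ?thesis by (simp add: X_def x_def)
        qed (use ij TD tD in auto)
      qed (use TD(1) tD(1) in auto)
      with sp show "\<omega> \<in> {\<omega> \<in> space M. T \<omega> = t}" by simp
    qed
  qed
  show "{\<omega> \<in> space M. T \<omega> = t} \<in> sets M"
    unfolding eq using J by (intro sets.finite_INT measurable_sets[OF meas]) auto
  have half: "prob (X p -` {x p} \<inter> space M) = 1 / 2" if "p \<in> J" for p
  proof -
    have "prob (X p -` {x p} \<inter> space M) = measure (distr M (count_space UNIV) (X p)) {x p}"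
      using meas[OF that] by (simp add: measure_distr)
    also have "\<dots> = pmf (map_pmf of_bool (bernoulli_pmf (1 / 2))) (x p)"
      by (simp add: distr[OF that] pmf.rep_eq)
    also have "\<dots> = 1 / 2"
    proof -
      have inj: "inj (of_bool :: bool \<Rightarrow> bit)" by (auto intro!: injI)
      \<comment> \<open>Written as an image under the injective \<open>of_bool\<close>, the bit has
        the same mass as its Bernoulli preimage, which is 1/2 for either value.\<close>
      have "x p = of_bool (x p = 1)" by (cases "x p") auto
      then show ?thesis
        using pmf_map_inj'[OF inj, of "bernoulli_pmf (1 / 2)" "x p = 1"]
        by (cases "x p = 1") auto
    qed
    finally show ?thesis .
  qed
  have "prob {\<omega> \<in> space M. T \<omega> = t} = (\<Prod>p\<in>J. prob (X p -` {x p} \<inter> space M))"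
    unfolding eq by (rule indep_varsD_finite[OF indep J(2) J(1)]) simp
  also have "\<dots> = (1 / 2) ^ card J"
    using prod.cong[OF refl half] by (simp only: prod_constant)
  finally show "measure M {\<omega> \<in> space M. T \<omega> = t} =
      (1 / 2) ^ card {(i, j). 1 \<le> i \<and> i < j \<and> j \<le> N}"
    by (simp add: J_def)
qed

text \<open>Turns expectations into averages over a finite set: \<open>h (T \<omega>)\<close> is a
  finite combination of indicators of the equally likely events
  \<open>T \<omega> = t\<close>.\<close>

lemma expectation_random_pre_transformation:
  fixes h :: "bit Matrix.mat \<Rightarrow> real"
  assumes "prob_space M" and T: "random_pre_transformation M N T" and N: "N \<ge> 2"
  shows "prob_space.expectation M (\<lambda>\<omega>. h (T \<omega>)) =
    (1 / 2) ^ card {(i, j). 1 \<le> i \<and> i < j \<and> j \<le> N} * (\<Sum>t | unit_upper_triangular N t. h t)"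
proof -
  interpret prob_space M by fact
  let ?U = "{t. unit_upper_triangular N t}"
  let ?S = "\<lambda>t. {\<omega> \<in> space M. T \<omega> = t}"
  note P = prob_random_pre_transformation_eq[OF assms(1) T N]
  have "expectation (\<lambda>\<omega>. h (T \<omega>)) = expectation (\<lambda>\<omega>. \<Sum>t\<in>?U. h t * indicator (?S t) \<omega>)"
  proof (rule Bochner_Integration.integral_cong[OF refl])
    fix \<omega> assume \<omega>: "\<omega> \<in> space M"
    then have "T \<omega> \<in> ?U" using T by (auto simp: random_pre_transformation_def)
    moreover have "(\<Sum>t\<in>?U. h t * indicator (?S t) \<omega>) = (\<Sum>t\<in>?U. if t = T \<omega> then h t else 0)"
      using \<omega> by (intro sum.cong) (auto simp: indicator_def)
    ultimately show "h (T \<omega>) = (\<Sum>t\<in>?U. h t * indicator (?S t) \<omega>)"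
      by (simp add: finite_unit_upper_triangular)
  qed
  also have "\<dots> = (\<Sum>t\<in>?U. expectation (\<lambda>\<omega>. h t * indicator (?S t) \<omega>))"
    using P(1) by (intro Bochner_Integration.integral_sum integrable_mult_right
      integrable_real_indicator) (auto simp: emeasure_eq_measure)
  also have "\<dots> = (\<Sum>t\<in>?U. h t * prob (?S t))"
    using P(1) by (intro sum.cong refl) (simp add: Int_absorb2)
  also have "\<dots> = (\<Sum>t\<in>?U. h t * (1 / 2) ^ card {(i, j). 1 \<le> i \<and> i < j \<and> j \<le> N})"
    using P(2) by (intro sum.cong refl) simp
  finally show ?thesis
    by (simp add: sum_distrib_right mult.commute)
qed

text \<open>A probability is the expectation of an indicator, so the averaging formula applies to
  it.\<close>

lemma row_weight_prob_eq_card: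
  assumes "prob_space M" and T: "random_pre_transformation M (2 ^ m) T" and "m \<ge> 1"
  shows "row_weight_prob M T m i d =
    (1 / 2) ^ card {(i, j). 1 \<le> i \<and> i < j \<and> j \<le> (2 ^ m :: nat)} *
    card {t. unit_upper_triangular (2 ^ m) t \<and> hamming_weight (g_row m t i) = d}"
proof -
  interpret prob_space M by fact
  have N: "(2::nat) ^ m \<ge> 2" using \<open>m \<ge> 1\<close> self_le_power[of "2::nat" m] by simp
  let ?E = "{\<omega> \<in> space M. hamming_weight (g_row m (T \<omega>) i) = d}"
  let ?h = "\<lambda>t. of_bool (hamming_weight (g_row m t i) = d) :: real"
  have "row_weight_prob M T m i d = expectation (indicator ?E)"
    by (simp add: row_weight_prob_def Int_absorb2)
  also have "\<dots> = expectation (\<lambda>\<omega>. ?h (T \<omega>))"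
    by (intro Bochner_Integration.integral_cong) (auto simp: indicator_def)
  also have "\<dots> = (1 / 2) ^ card {(i, j). 1 \<le> i \<and> i < j \<and> j \<le> (2 ^ m :: nat)} *
      (\<Sum>t | unit_upper_triangular (2 ^ m) t. ?h t)"
    by (rule expectation_random_pre_transformation[OF assms(1) T N])
  also have "(\<Sum>t | unit_upper_triangular (2 ^ m) t. ?h t) =
      real (card {t. unit_upper_triangular (2 ^ m) t \<and> hamming_weight (g_row m t i) = d})"
    using card_filter_eq_sum[OF finite_unit_upper_triangular[of "2 ^ m"],
        of "\<lambda>t. hamming_weight (g_row m t i) = d"] by simp
  finally show ?thesis .
qed

theorem mainTheorem1:
  fixes M :: "'w measure" and T :: "'w \<Rightarrow> bit Matrix.mat"
    and m K d :: nat and A :: "nat set" and I :: "nat \<Rightarrow> nat"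
  assumes "m \<ge> 1"
    and "K \<ge> 1"
    and "strict_mono_on {1..K} I"
    and "A = I ` {1..K}"
    and "A \<subseteq> {1..2 ^ m}"
    and "prob_space M"
    and "random_pre_transformation M (2 ^ m) T"
    and "d \<ge> 1"
  shows "prob_space.expectation M (\<lambda>\<omega>. real (num_codewords m A (T \<omega>) d)) =
    (\<Sum>j | 1 \<le> j \<and> j \<le> K \<and> hamming_weight (f_row m (I j)) \<le> d.
       2 ^ (K - j) * row_weight_prob M T m (I j) d)"
proof -
  let ?c = "(1 / 2 :: real) ^ card {(i, j). 1 \<le> i \<and> i < j \<and> j \<le> (2 ^ m :: nat)}"
  let ?n = "\<lambda>i. card {t. unit_upper_triangular (2 ^ m) t \<and> hamming_weight (g_row m t i) = d}"
  let ?P = "\<lambda>i. row_weight_prob M T m i d"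
  have N: "(2::nat) ^ m \<ge> 2" using \<open>m \<ge> 1\<close> self_le_power[of "2::nat" m] by simp
  have P: "?P i = ?c * ?n i" for i
    by (rule row_weight_prob_eq_card[OF assms(6,7,1)])
  have inj: "inj_on I {1..K}"
    by (rule strict_mono_on_imp_inj_on[OF assms(3)])
  \<comment> \<open>Since \<open>I\<close> is strictly increasing, the elements of \<open>A\<close>
    beyond \<open>I j\<close> are the images of \<open>j + 1\<close> up to \<open>K\<close>.\<close>
  have later: "card {k \<in> A. I j < k} = K - j" if j: "j \<in> {1..K}" for j
  proof -
    have "I j < I k \<longleftrightarrow> j < k" if "k \<in> {1..K}" for k
      using strict_mono_on_less[OF assms(3) j that] .
    then have "{k \<in> A. I j < k} = I ` {j<..K}"
      using j unfolding assms(4) by force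
    moreover have "card (I ` {j<..K}) = card {j<..K}"
      using j by (intro card_image inj_on_subset[OF inj]) auto
    ultimately show ?thesis by simp
  qed
  \<comment> \<open>The weight of \<open>g_row\<close> is at least that of \<open>f_row\<close>,
    hence above \<open>d\<close> for every matrix.\<close>
  have zero: "?P i = 0" if "i \<in> A" "\<not> hamming_weight (f_row m i) \<le> d" for i
  proof -
    have "{t. unit_upper_triangular (2 ^ m) t \<and> hamming_weight (g_row m t i) = d} = {}"
      using hamming_weight_g_row_ge[of m _ i] that assms(5) by fastforce
    then show ?thesis by (simp only: P card.empty of_nat_0 mult_zero_right)
  qed
  have "prob_space.expectation M (\<lambda>\<omega>. real (num_codewords m A (T \<omega>) d)) =
      ?c * (\<Sum>t | unit_upper_triangular (2 ^ m) t. real (num_codewords m A t d))"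
    by (rule expectation_random_pre_transformation[OF assms(6,7) N])
  also have "\<dots> = ?c * real (\<Sum>i\<in>A. 2 ^ card {k \<in> A. i < k} * ?n i)"
    by (simp only: sum_num_codewords[OF assms(5,8)] flip: of_nat_sum)
  \<comment> \<open>The common probability \<open>?c\<close> of a single matrix turns each count
    \<open>?n i\<close> back into a probability.\<close>
  also have "\<dots> = (\<Sum>i\<in>A. 2 ^ card {k \<in> A. i < k} * ?P i)"
    by (simp add: P sum_distrib_left mult_ac)
  also have "\<dots> = (\<Sum>j\<in>{1..K}. 2 ^ card {k \<in> A. I j < k} * ?P (I j))"
    unfolding assms(4) by (rule sum.reindex_cong[OF inj refl]) simp
  also have "\<dots> = (\<Sum>j\<in>{1..K}. 2 ^ (K - j) * ?P (I j))"
    using later by (intro sum.cong refl) simp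
  also have "\<dots> = (\<Sum>j | 1 \<le> j \<and> j \<le> K \<and> hamming_weight (f_row m (I j)) \<le> d.
       2 ^ (K - j) * ?P (I j))"
    using zero by (intro sum.mono_neutral_right) (auto simp: assms(4))
  finally show ?thesis .
qed

end
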